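(* Let $\mathcal{A}>0$, $\mathcal{C}>0$ and $\gamma\in\left(\frac{\pi}{2},\pi\right]$. If $\bar\phi_0\in[0,\pi]$ is a stable equilibrium point (in the sense defined in the context), then $(\bar\phi_0,\mathcal{C})$ lies in the non-intersection region.
   Context: For parameters $\mathcal{A}>0$, $\mathcal{C}>0$ and contact angle $\gamma\in[0,\pi]$, the dimensionless total force on the floating cylinder, as a function of the wetting angle $\phi_0\in[0,\pi]$, is $$\hat F_T(\phi_0)=-\mathcal{A}\mathcal{C}^2-2\sin(\phi_0+\gamma)-4\mathcal{C}\cos\left(\frac{\phi_0+\gamma}{2}\right)\sin\phi_0-\frac12\mathcal{C}^2\sin 2\phi_0+\mathcal{C}^2\phi_0.$$ The total energy, divided by the positive constant $\sigma a$ (surface tension times radius), is $$\begin{aligned}\hat E_T(\phi_0)={}&\mathcal{A}\mathcal{C}^2\left[\cos\phi_0+\tfrac{2}{\mathcal{C}}\cos\left(\tfrac{\phi_0+\gamma}{2}\right)\right]-2\phi_0\cos\gamma+\tfrac{8}{3\mathcal{C}}\left[1-\sin^3\left(\tfrac{\phi_0+\gamma}{2}\right)\right]+2\sin\phi_0\cos(\phi_0+\gamma)\\&+\mathcal{C}^2\left[\tfrac1{12}\sin3\phi_0-\phi_0\cos\phi_0+\tfrac34\sin\phi_0\right]+\mathcal{C}\cos\left(\tfrac{\phi_0+\gamma}{2}\right)\left[\sin2\phi_0-2\phi_0\right].\end{aligned}$$ An equilibrium point is a $\bar\phi_0\in[0,\pi]$ with $\hat F_T(\bar\phi_0)=0$.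 An equilibrium point is called stable if it is a strict local minimum of $\hat E_T$ on $[0,\pi]$, and unstable if it is not a local minimum of $\hat E_T$ on $[0,\pi]$. The intersection function is $$I(\phi_0,\mathcal{C})=\mathcal{C}\sin\phi_0-\sqrt2-\ln\left(\tan\frac{\pi}{8}\right)+2\sin\left(\frac{\phi_0+\gamma}{2}\right)+\ln\left|\tan\left(\frac{\phi_0+\gamma-\pi}{4}\right)\right|.$$ For given $\gamma$, a pair $(\phi_0,\mathcal{C})$ with $\phi_0\in[0,\pi]$, $\mathcal{C}>0$ lies in the intersection region (the fluid interfaces on the two sides of the cylinder meet) if $I(\phi_0,\mathcal{C})\le 0$ and either $\gamma\in\left[0,\frac{\pi}{2}\right]$ and $\phi_0\in\left[0,\frac{\pi}{2}-\gamma\right]$, or $\gamma\in\left[\frac{\pi}{2},\pi\right]$ and $\phi_0\in\left[\frac{3\pi}{2}-\gamma,\pi\right]$. Otherwise it lies in the non-intersection region. *)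

theory Defs
  imports Complex_Main
begin

text \<open>
  Throughout, \<open>A\<close> and \<open>C\<close> are the dimensionless parameters \<open>\<A>\<close> and \<open>\<C>\<close>, \<open>\<gamma>\<close> is the contact angle
  and \<open>\<phi>\<close> is the wetting angle.
\<close>

definition total_force :: "real \<Rightarrow> real \<Rightarrow> real \<Rightarrow> real \<Rightarrow> real" where
  "total_force A C \<gamma> \<phi> =
     - A * C\<^sup>2 - 2 * sin (\<phi> + \<gamma>) - 4 * C * cos ((\<phi> + \<gamma>) / 2) * sin \<phi>
     - 1 / 2 * C\<^sup>2 * sin (2 * \<phi>) + C\<^sup>2 * \<phi>"

definition total_energy :: "real \<Rightarrow> real \<Rightarrow> real \<Rightarrow> real \<Rightarrow> real" where
  "total_energy A C \<gamma> \<phi> =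
     A * C\<^sup>2 * (cos \<phi> + 2 / C * cos ((\<phi> + \<gamma>) / 2))
     - 2 * \<phi> * cos \<gamma>
     + 8 / (3 * C) * (1 - sin ((\<phi> + \<gamma>) / 2) ^ 3)
     + 2 * sin \<phi> * cos (\<phi> + \<gamma>)
     + C\<^sup>2 * (1 / 12 * sin (3 * \<phi>) - \<phi> * cos \<phi> + 3 / 4 * sin \<phi>)
     + C * cos ((\<phi> + \<gamma>) / 2) * (sin (2 * \<phi>) - 2 * \<phi>)"

definition strict_local_min_on :: "(real \<Rightarrow> real) \<Rightarrow> real set \<Rightarrow> real \<Rightarrow> bool" where
  "strict_local_min_on f S x \<longleftrightarrow>
     x \<in> S \<and> (\<exists>\<delta>>0. \<forall>y\<in>S. y \<noteq> x \<and> \<bar>y - x\<bar> < \<delta> \<longrightarrow> f x < f y)"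

definition equilibrium_point :: "real \<Rightarrow> real \<Rightarrow> real \<Rightarrow> real \<Rightarrow> bool" where
  "equilibrium_point A C \<gamma> \<phi> \<longleftrightarrow> \<phi> \<in> {0..pi} \<and> total_force A C \<gamma> \<phi> = 0"

definition stable_equilibrium_point :: "real \<Rightarrow> real \<Rightarrow> real \<Rightarrow> real \<Rightarrow> bool" where
  "stable_equilibrium_point A C \<gamma> \<phi> \<longleftrightarrow>
     equilibrium_point A C \<gamma> \<phi> \<and> strict_local_min_on (total_energy A C \<gamma>) {0..pi} \<phi>"

text \<open>
  The value \<open>ln 0 = 0\<close> (at \<open>\<phi> + \<gamma> = \<pi>\<close>) is irrelevant below: the angles admitted in the
  intersection region satisfy \<open>\<phi> + \<gamma> \<in> [0, \<pi>/2] \<union> [3\<pi>/2, 2\<pi>]\<close>.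
\<close>

definition intersection_fun :: "real \<Rightarrow> real \<Rightarrow> real \<Rightarrow> real" where
  "intersection_fun \<gamma> \<phi> C =
     C * sin \<phi> - sqrt 2 - ln (tan (pi / 8)) + 2 * sin ((\<phi> + \<gamma>) / 2)
     + ln \<bar>tan ((\<phi> + \<gamma> - pi) / 4)\<bar>"

definition intersection_region :: "real \<Rightarrow> (real \<times> real) set" where
  "intersection_region \<gamma> =
     {(\<phi>, C). \<phi> \<in> {0..pi} \<and> C > 0 \<and> intersection_fun \<gamma> \<phi> C \<le> 0 \<and>
        (\<gamma> \<in> {0..pi / 2} \<and> \<phi> \<in> {0..pi / 2 - \<gamma>} \<or>
         \<gamma> \<in> {pi / 2..pi} \<and> \<phi> \<in> {3 * pi / 2 - \<gamma>..pi})}"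

definition non_intersection_region :: "real \<Rightarrow> (real \<times> real) set" where
  "non_intersection_region \<gamma> = ({0..pi} \<times> {0<..}) - intersection_region \<gamma>"

end

theory Submission
  imports Defs
begin

text \<open>
  The energy satisfies \<open>E' = (sin \<phi> + sin u / C) F\<close> with \<open>u = (\<phi> + \<gamma>) / 2\<close>, where the first factor is
  nonnegative, so it suffices to show \<open>F' < 0\<close> at every equilibrium in the intersection region: then
  \<open>F > 0\<close> immediately to the left, so \<open>E\<close> is nondecreasing there. With \<open>x = C sin \<phi>\<close> and
  \<open>s = sin u\<close> one has \<open>F' / 2 = x\<^sup>2 + x s - (1 - 2 s\<^sup>2) - 2 C cos u cos \<phi>\<close>. In the
  region \<open>cos u\<close> and \<open>cos \<phi>\<close> are nonpositive, and \<open>I \<le> 0\<close> reads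
  \<open>x \<le> G s := (artanh s - 2 s) - (artanh r - 2 r)\<close> with \<open>r = sqrt 2 / 2\<close>. The mean value theorem
  gives \<open>G s \<le> r (1 - 2 s\<^sup>2)\<close>, whence \<open>x\<^sup>2 + x s \<le> 1 - 2 s\<^sup>2\<close>.
  Strictness comes from \<open>cos u cos \<phi> > 0\<close>: if \<open>cos \<phi> = 0\<close>, then \<open>\<phi> = \<pi>/2\<close> and \<open>\<gamma> = \<pi>\<close>, so that \<open>s = r\<close> and
  \<open>C = x \<le> 0\<close>.
\<close>

text \<open>The half-angle formulas turn the quotient inside \<open>artanh (cos v)\<close> into the
  square of \<open>cot (v / 2)\<close>; the factor 1/2 of \<open>artanh\<close> cancels the
  square.\<close>

lemma ln_tan_half:
  fixes v :: real
  assumes "0 < v" "v < pi"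
  shows "ln (tan (v / 2)) = - artanh (cos v)"
proof -
  define c where "c = cos (v / 2)"
  define s where "s = sin (v / 2)"
  have c: "c > 0" unfolding c_def using assms by (intro cos_gt_zero_pi) auto
  have s: "s > 0" unfolding s_def using assms by (intro sin_gt_zero) auto
  have cv: "cos v = c\<^sup>2 - s\<^sup>2" using cos_double[of "v / 2"] by (simp add: c_def s_def)
  have one: "c\<^sup>2 + s\<^sup>2 = 1" by (simp add: c_def s_def)
  have "(1 + cos v) / (1 - cos v) = c\<^sup>2 / s\<^sup>2"
  proof -
    have "1 + cos v = 2 * c\<^sup>2" "1 - cos v = 2 * s\<^sup>2" using cv one by auto
    then show ?thesis by simp
  qed
  also have "\<dots> = (c / s)\<^sup>2" by (simp add: power_divide)
  finally have "artanh (cos v) = ln (c / s)"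
    using c s by (simp add: artanh_def ln_realpow)
  also have "\<dots> = - ln (s / c)" using c s by (simp add: ln_div)
  finally show ?thesis by (simp add: tan_def c_def s_def)
qed

lemma intersection_fun_eq:
  fixes C \<gamma> \<phi> :: real
  assumes "pi < \<phi> + \<gamma>" "\<phi> + \<gamma> < 3 * pi"
  shows "intersection_fun \<gamma> \<phi> C =
    C * sin \<phi> - sqrt 2 + artanh (sqrt 2 / 2)
      + 2 * sin ((\<phi> + \<gamma>) / 2) - artanh (sin ((\<phi> + \<gamma>) / 2))"
proof -
  \<comment> \<open>With this shift the tangent has argument \<open>v / 2\<close> in (0, pi/2), so
    the absolute value drops. The constant \<open>ln (tan (pi / 8))\<close> is the case
    \<open>v = pi / 4\<close>.\<close>
  define v where "v = (\<phi> + \<gamma> - pi) / 2"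
  have v: "0 < v" "v < pi" using assms by (auto simp: v_def)
  have arg: "(\<phi> + \<gamma> - pi) / 4 = v / 2" by (simp add: v_def)
  have "tan (v / 2) > 0" using v by (intro tan_gt_zero) auto
  moreover have "cos v = sin ((\<phi> + \<gamma>) / 2)"
  proof -
    have "v = (\<phi> + \<gamma>) / 2 - pi / 2" by (simp add: v_def field_simps)
    then show ?thesis by (simp add: cos_diff)
  qed
  ultimately have 1: "ln \<bar>tan ((\<phi> + \<gamma> - pi) / 4)\<bar> = - artanh (sin ((\<phi> + \<gamma>) / 2))"
    unfolding arg using ln_tan_half[OF v] by simp
  have "ln (tan (pi / 8)) = - artanh (sqrt 2 / 2)"
    using ln_tan_half[of "pi / 4"] by (simp add: cos_45)
  with 1 show ?thesis unfolding intersection_fun_def by simp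
qed

text \<open>Mean value theorem for \<open>artanh t - 2 * t\<close> on \<open>[s, r]\<close>. Its
  derivative increases for \<open>t \<ge> 0\<close>, so it is bounded below by its value at
  \<open>s\<close>, which contributes the factor \<open>1 - 2 * s\<^sup>2\<close>.\<close>

lemma artanh_difference_bound:
  fixes s :: real
  assumes "0 \<le> s" "s \<le> sqrt 2 / 2"
  shows "(artanh s - 2 * s) - (artanh (sqrt 2 / 2) - sqrt 2) \<le> sqrt 2 / 2 * (1 - 2 * s\<^sup>2)"
proof (cases "s = sqrt 2 / 2")
  case True
  show ?thesis unfolding True by (simp add: power_divide)
next
  case False
  define r :: real where "r = sqrt 2 / 2"
  have sr: "s < r" using False assms by (simp add: r_def)
  have r2: "r\<^sup>2 = 1 / 2" by (simp add: r_def power_divide)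
  have r: "0 < r" "r < 1" using real_less_lsqrt[of 2 2] by (auto simp: r_def)
  have "\<exists>z>s. z < r \<and> (artanh r - 2 * r) - (artanh s - 2 * s) = (r - s) * (1 / (1 - z\<^sup>2) - 2)"
    using sr
  proof (rule MVT2)
    fix t assume "s \<le> t" "t \<le> r"
    then have "\<bar>t\<bar> < 1" using assms r by auto
    then show "((\<lambda>t. artanh t - 2 * t) has_real_derivative 1 / (1 - t\<^sup>2) - 2) (at t)"
      by (auto intro!: derivative_eq_intros)
  qed
  then obtain z where z: "s < z" "z < r"
    and eq: "(artanh r - 2 * r) - (artanh s - 2 * s) = (r - s) * (1 / (1 - z\<^sup>2) - 2)"
    by blast
  have sz: "s\<^sup>2 \<le> z\<^sup>2" using z assms by (intro power_mono) auto
  have z1: "z\<^sup>2 < 1 / 2" using power_strict_mono[of z r 2] z assms r2 by simp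
  have s1: "1 - s\<^sup>2 > 0" using sz z1 by simp
  have "(artanh s - 2 * s) - (artanh r - 2 * r) = (r - s) * (2 - 1 / (1 - z\<^sup>2))"
    using eq by (simp add: algebra_simps)
  also have "\<dots> \<le> (r - s) * (2 - 1 / (1 - s\<^sup>2))"
    using sr sz z1 s1 by (intro mult_left_mono diff_left_mono divide_left_mono) auto
  also have "\<dots> = (r - s) / (1 - s\<^sup>2) * (1 - 2 * s\<^sup>2)"
    using s1 by (simp add: field_simps)
  also have "\<dots> \<le> r * (1 - 2 * s\<^sup>2)"
  proof (rule mult_right_mono)
    \<comment> \<open>This is the claim \<open>(r - s) / (1 - s\<^sup>2) \<le> r\<close> after
      clearing the denominator; it holds since \<open>r * s \<le> 1\<close>.\<close>
    have "r * s\<^sup>2 \<le> 1 * s"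
      unfolding power2_eq_square mult.assoc[symmetric]
      using assms r sr by (intro mult_right_mono mult_le_one) auto
    then show "(r - s) / (1 - s\<^sup>2) \<le> r" using s1 by (simp add: divide_simps algebra_simps)
  qed (use sz z1 in auto)
  finally show ?thesis by (simp add: r_def)
qed

text \<open>Double and triple angle formulas, with \<open>\<gamma>\<close> split as
  \<open>(\<phi> + \<gamma>) - \<phi>\<close>, express both sides as polynomials in
  \<open>S\<close>, \<open>K\<close>, \<open>s\<close>, \<open>k\<close>, \<open>\<phi>\<close> with
  coefficients in \<open>A\<close>, \<open>C\<close> and \<open>1 / C\<close>, and these
  agree.\<close>

lemma total_energy_has_derivative:
  assumes "C \<noteq> 0"
  shows "(total_energy A C \<gamma> has_real_derivative
    (sin \<phi> + sin ((\<phi> + \<gamma>) / 2) / C) * total_force A C \<gamma> \<phi>) (at \<phi>)"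
proof -
  define u where "u = (\<phi> + \<gamma>) / 2"
  define S where "S = sin \<phi>"
  define K where "K = cos \<phi>"
  define s where "s = sin u"
  define k where "k = cos u"
  have SK: "K\<^sup>2 = 1 - S\<^sup>2"
    by (simp add: S_def K_def cos_squared_eq)
  have \<gamma>: "\<gamma> = (\<phi> + \<gamma>) - \<phi>" and u2: "\<phi> + \<gamma> = 2 * u" by (simp_all add: u_def)
  have sin\<psi>: "sin (\<phi> + \<gamma>) = 2 * s * k" and cos\<psi>: "cos (\<phi> + \<gamma>) = k\<^sup>2 - s\<^sup>2"
    unfolding u2 s_def k_def by (simp_all add: sin_double cos_double)
  have cos\<gamma>: "cos \<gamma> = (k\<^sup>2 - s\<^sup>2) * K + 2 * s * k * S"
    by (subst \<gamma>) (simp only: cos_diff sin\<psi> cos\<psi> S_def K_def)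
  have sin2: "sin (2 * \<phi>) = 2 * S * K" and cos2: "cos (2 * \<phi>) = 1 - 2 * S\<^sup>2"
    by (simp_all add: sin_double cos_double_sin S_def K_def)
  have "cos (3 * \<phi>) = K * (4 * K\<^sup>2 - 3)"
    unfolding cos_treble_cos K_def by (simp add: power3_eq_cube power2_eq_square algebra_simps)
  then have cos3: "cos (3 * \<phi>) = K - 4 * K * S\<^sup>2"
    unfolding SK by (simp add: algebra_simps)
  let ?D = "A * C\<^sup>2 * (- S - s / C) - 2 * cos \<gamma> - 4 / C * s\<^sup>2 * k
     + 2 * (K * cos (\<phi> + \<gamma>) - S * sin (\<phi> + \<gamma>))
     + C\<^sup>2 * (cos (3 * \<phi>) / 4 - K + \<phi> * S + 3 / 4 * K)
     + C * (k * (2 * cos (2 * \<phi>) - 2) - s / 2 * (sin (2 * \<phi>) - 2 * \<phi>))"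
  have "(total_energy A C \<gamma> has_real_derivative ?D) (at \<phi>)"
    unfolding total_energy_def[abs_def] S_def K_def s_def k_def u_def
    using assms
    by (auto intro!: derivative_eq_intros simp: field_simps power2_eq_square)
  also have "?D = (S + s / C) * (- A * C\<^sup>2 - 2 * (2 * s * k) - 4 * C * k * S
     - 1 / 2 * C\<^sup>2 * (2 * S * K) + C\<^sup>2 * \<phi>)"
    unfolding cos\<gamma> sin\<psi> cos\<psi> sin2 cos2 cos3 using assms
    by (simp add: field_simps power2_eq_square)
  finally show ?thesis
    unfolding total_force_def sin\<psi> sin2 by (simp add: S_def s_def k_def u_def)
qed

lemma total_force_has_derivative:
  "(total_force A C \<gamma> has_real_derivative
    2 * ((C * sin \<phi>)\<^sup>2 + C * sin \<phi> * sin ((\<phi> + \<gamma>) / 2) - (1 - 2 * (sin ((\<phi> + \<gamma>) / 2))\<^sup>2)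
      - 2 * C * cos ((\<phi> + \<gamma>) / 2) * cos \<phi>)) (at \<phi>)"
proof -
  have cos\<psi>: "cos (\<phi> + \<gamma>) = 1 - 2 * (sin ((\<phi> + \<gamma>) / 2))\<^sup>2"
    by (simp del: distrib_left_numeral flip: cos_double_sin)
  have "(total_force A C \<gamma> has_real_derivative
     - 2 * cos (\<phi> + \<gamma>) - 4 * C * (cos ((\<phi> + \<gamma>) / 2) * cos \<phi> - sin ((\<phi> + \<gamma>) / 2) / 2 * sin \<phi>)
     - C\<^sup>2 * cos (2 * \<phi>) + C\<^sup>2) (at \<phi>)"
    unfolding total_force_def[abs_def]
    by (auto intro!: derivative_eq_intros simp: algebra_simps)
  then show ?thesis
    unfolding cos\<psi> cos_double_sin by (simp add: algebra_simps power2_eq_square)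
qed

lemma force_derivative_neg_in_intersection_region:
  assumes "C > 0" "\<gamma> \<in> {pi / 2<..pi}" "(\<phi>, C) \<in> intersection_region \<gamma>"
  shows "(C * sin \<phi>)\<^sup>2 + C * sin \<phi> * sin ((\<phi> + \<gamma>) / 2) - (1 - 2 * (sin ((\<phi> + \<gamma>) / 2))\<^sup>2)
      - 2 * C * cos ((\<phi> + \<gamma>) / 2) * cos \<phi> < 0"
proof -
  define u where "u = (\<phi> + \<gamma>) / 2"
  define s where "s = sin u"
  define r :: real where "r = sqrt 2 / 2"
  define x where "x = C * sin \<phi>"
  \<comment> \<open>As \<open>\<gamma> > pi / 2\<close>, only the second alternative of the region
    can occur.\<close>
  have \<phi>: "\<phi> \<in> {3 * pi / 2 - \<gamma>..pi}" and I: "intersection_fun \<gamma> \<phi> C \<le> 0"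
    using assms(2,3) by (auto simp: intersection_region_def)
  have u: "3 * pi / 4 \<le> u" "u \<le> pi" and \<phi>2: "pi / 2 \<le> \<phi>" "\<phi> \<le> pi"
    using \<phi> assms(2) by (auto simp: u_def)
  have r2: "r\<^sup>2 = 1 / 2" by (simp add: r_def power_divide)
  have s0: "0 \<le> s" unfolding s_def using u by (intro sin_ge_zero) auto
  have sr: "s \<le> r"
  proof -
    have "sin (pi - u) \<le> sin (pi / 4)" using u by (intro sin_monotone_2pi_le) auto
    then show ?thesis by (simp add: s_def r_def sin_45)
  qed
  have x0: "0 \<le> x" unfolding x_def using \<phi>2 assms(1)
    by (intro mult_nonneg_nonneg sin_ge_zero) (auto intro: order_trans[of 0 "pi / 2"])
  have "x \<le> (artanh s - 2 * s) - (artanh (sqrt 2 / 2) - sqrt 2)"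
  proof -
    have "pi < \<phi> + \<gamma>" "\<phi> + \<gamma> < 3 * pi"
      using u pi_gt_zero unfolding u_def by argo+
    then show ?thesis using I intersection_fun_eq[of \<phi> \<gamma> C] by (simp add: x_def s_def u_def)
  qed
  also have "\<dots> \<le> r * (1 - 2 * s\<^sup>2)"
    using artanh_difference_bound[of s] s0 sr by (simp add: r_def)
  finally have xr: "x \<le> r * (1 - 2 * s\<^sup>2)" .
  have d: "0 \<le> 1 - 2 * s\<^sup>2" using power_mono[OF sr s0, of 2] r2 by simp
  have "x\<^sup>2 + x * s = x * (x + s)" by (simp add: algebra_simps power2_eq_square)
  also have "\<dots> \<le> (r * (1 - 2 * s\<^sup>2)) * (r * (1 - 2 * s\<^sup>2) + s)"
    using xr x0 s0 by (intro mult_mono) auto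
  also have "\<dots> = (1 - 2 * s\<^sup>2) * (r\<^sup>2 * (1 - 2 * s\<^sup>2) + r * s)"
    by (simp add: algebra_simps power2_eq_square)
  also have "\<dots> \<le> (1 - 2 * s\<^sup>2) * 1"
  proof (rule mult_left_mono[OF _ d])
    have "0 \<le> (r - s)\<^sup>2" by simp
    \<comment> \<open>By this AM-GM bound, the bracket is at most
      \<open>3 / 4 - s\<^sup>2 / 2\<close>.\<close>
    then have "r * s \<le> (1 / 2 + s\<^sup>2) / 2" using r2 by (simp add: power2_diff)
    then show "r\<^sup>2 * (1 - 2 * s\<^sup>2) + r * s \<le> 1" unfolding r2
      using zero_le_power2[of s] by argo
  qed
  finally have le: "x\<^sup>2 + x * s \<le> 1 - 2 * s\<^sup>2" by simp
  have "\<phi> \<noteq> pi / 2"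
  proof
    assume eq: "\<phi> = pi / 2"
    then have "u = pi - pi / 4" using \<phi> assms(2) u by (auto simp: u_def)
    then have "s = r" by (simp only: s_def sin_pi_minus r_def sin_45)
    then show False using xr r2 assms(1) eq by (simp add: x_def)
  qed
  then have "cos \<phi> < 0" using \<phi>2 cos_gt_zero_pi[of "pi - \<phi>"] by simp
  moreover have "cos u < 0" using u cos_gt_zero_pi[of "pi - u"] pi_gt_zero by simp
  ultimately have "2 * C * cos u * cos \<phi> > 0"
    using assms(1) by (simp add: zero_less_mult_iff mult_less_0_iff)
  then show ?thesis using le unfolding x_def s_def u_def by linarith
qed

theorem mainTheorem9:
  fixes A C \<gamma> \<phi> :: real
  assumes "A > 0" and "C > 0" and "\<gamma> \<in> {pi / 2<..pi}"
    and "\<phi> \<in> {0..pi}"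
    and "stable_equilibrium_point A C \<gamma> \<phi>"
  shows "(\<phi>, C) \<in> non_intersection_region \<gamma>"
proof (rule ccontr)
  assume "\<not> ?thesis"
  then have reg: "(\<phi>, C) \<in> intersection_region \<gamma>"
    using assms(2,4) by (auto simp: non_intersection_region_def)
  then have \<phi>: "pi / 2 \<le> \<phi>" "\<phi> \<le> pi"
    using assms(3) by (auto simp: intersection_region_def)
  have F0: "total_force A C \<gamma> \<phi> = 0"
    using assms(5) by (simp add: stable_equilibrium_point_def equilibrium_point_def)
  obtain \<delta> where \<delta>: "\<delta> > 0"
    and minE: "\<And>y. y \<in> {0..pi} \<Longrightarrow> y \<noteq> \<phi> \<Longrightarrow> \<bar>y - \<phi>\<bar> < \<delta> \<Longrightarrow>
      total_energy A C \<gamma> \<phi> < total_energy A C \<gamma> y"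
    using assms(5) by (auto simp: stable_equilibrium_point_def strict_local_min_on_def)
  \<comment> \<open>Only left neighbours are used: they stay in \<open>[0, pi]\<close> even when
    \<open>\<phi> = pi\<close>.\<close>
  obtain d where d: "d > 0"
    and pos: "\<And>h. h > 0 \<Longrightarrow> h < d \<Longrightarrow> total_force A C \<gamma> \<phi> < total_force A C \<gamma> (\<phi> - h)"
    using DERIV_neg_dec_left[OF total_force_has_derivative]
      force_derivative_neg_in_intersection_region[OF assms(2,3) reg] by force
  \<comment> \<open>The division by 4 makes \<open>h\<close> strictly smaller than \<open>d\<close>,
    \<open>\<delta>\<close> and \<open>pi / 2\<close>; the last keeps \<open>\<phi> - h\<close>
    positive because \<open>\<phi> \<ge> pi / 2\<close>.\<close>
  define h where "h = min (min d \<delta>) pi / 4"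
  have h: "0 < h" "h < d" "h < \<delta>" "h < pi / 2"
    using d \<delta> pi_gt_zero by (auto simp: h_def min_def)
  have "total_energy A C \<gamma> (\<phi> - h) \<le> total_energy A C \<gamma> \<phi>"
  proof (rule DERIV_nonneg_imp_nondecreasing[where f = "total_energy A C \<gamma>"])
    fix y assume y: "\<phi> - h \<le> y" "y \<le> \<phi>"
    \<comment> \<open>The force vanishes at \<open>y = \<phi>\<close> and is positive to its left;
      the sines below are nonnegative because both angles lie in \<open>[0, pi]\<close>.\<close>
    have "total_force A C \<gamma> y \<ge> 0"
      using pos[of "\<phi> - y"] y h F0 by (cases "y = \<phi>") auto
    moreover have "sin y \<ge> 0" using y h \<phi> by (intro sin_ge_zero) auto
    moreover have "sin ((y + \<gamma>) / 2) \<ge> 0"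
      using y h \<phi> assms(3) by (intro sin_ge_zero) auto
    ultimately show "\<exists>D. (total_energy A C \<gamma> has_real_derivative D) (at y) \<and> D \<ge> 0"
      using assms(2)
      by (intro exI[of _ "(sin y + sin ((y + \<gamma>) / 2) / C) * total_force A C \<gamma> y"] conjI
          total_energy_has_derivative mult_nonneg_nonneg add_nonneg_nonneg) auto
  qed (use h in auto)
  moreover have "total_energy A C \<gamma> \<phi> < total_energy A C \<gamma> (\<phi> - h)"
    using minE[of "\<phi> - h"] h \<phi> by auto
  ultimately show False by simp
qed

end
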